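(* Let $X$ be a real normed linear space, $\Omega\subseteq X$ a nonempty closed set, $v\in X$ nonzero, and $T(x):=\inf\{t\ge 0\mid x+tv\in\Omega\}$. Let $\bar x\in\Omega$. If $\Omega$ is epi-Lipschitz at $\bar x$ in the direction $v$, then $T$ is Lipschitz continuous around $\bar x$. Moreover, the converse holds if $v\in\Omega_\infty$.
   Context: $T$ takes values in $[0,\infty]$ with $\inf\emptyset=\infty$. $B(x;\delta)$ denotes the closed ball. $\Omega$ is epi-Lipschitz at $\bar x$ in the direction $v\ne0$ if there exists $\delta>0$ such that for all $\omega\in\Omega\cap B(\bar x;\delta)$, $u\in B(v;\delta)$ and $\lambda\in[0,\delta]$ one has $\omega+\lambda u\in\Omega$. $T$ is Lipschitz continuous around $\bar x$ if there are $\ell\ge0$ and $\delta>0$ such that $T$ is finite on $B(\bar x;\delta)$ and $|T(x)-T(y)|\le\ell\|x-y\|$ for all $x,y\in B(\bar x;\delta)$. The recession cone is $\Omega_\infty:=\{u\in X\mid\omega+\lambda u\in\Omega\text{ for all }\omega\in\Omega,\ \lambda\ge0\}$. *)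

theory Defs
  imports "HOL-Analysis.Analysis"
begin

(* The infimum is taken in the extended reals, where Inf {} = \<infinity>; hence the value
   is \<infinity> exactly when the ray from x in direction v misses \<Omega>. *)
definition dir_min_time :: "'a::real_normed_vector set \<Rightarrow> 'a \<Rightarrow> 'a \<Rightarrow> ereal" where
  "dir_min_time \<Omega> v x = Inf (ereal ` {t. 0 \<le> t \<and> x + t *\<^sub>R v \<in> \<Omega>})"

lemma dir_min_time_nonneg: "0 \<le> dir_min_time \<Omega> v x"
  unfolding dir_min_time_def by (rule Inf_greatest) auto

lemma dir_min_time_eq_infinity_iff:
  "dir_min_time \<Omega> v x = \<infinity> \<longleftrightarrow> (\<forall>t\<ge>0. x + t *\<^sub>R v \<notin> \<Omega>)"
  unfolding dir_min_time_def by (auto simp: Inf_eq_PInfty)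

definition epi_Lipschitz_at :: "'a::real_normed_vector set \<Rightarrow> 'a \<Rightarrow> 'a \<Rightarrow> bool" where
  "epi_Lipschitz_at \<Omega> x v \<longleftrightarrow>
     v \<noteq> 0 \<and>
     (\<exists>\<delta>>0. \<forall>\<omega> \<in> \<Omega> \<inter> cball x \<delta>. \<forall>u \<in> cball v \<delta>. \<forall>l \<in> {0..\<delta>}. \<omega> + l *\<^sub>R u \<in> \<Omega>)"

(* For ereal, \<bar>f y\<bar> \<noteq> \<infinity> says that f y is a real number. *)
definition Lipschitz_around :: "('a::real_normed_vector \<Rightarrow> ereal) \<Rightarrow> 'a \<Rightarrow> bool" where
  "Lipschitz_around f x \<longleftrightarrow>
     (\<exists>L\<ge>0. \<exists>\<delta>>0.
        (\<forall>y \<in> cball x \<delta>. \<bar>f y\<bar> \<noteq> \<infinity>) \<and>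
        (\<forall>y \<in> cball x \<delta>. \<forall>z \<in> cball x \<delta>. \<bar>f y - f z\<bar> \<le> ereal (L * norm (y - z))))"

definition recession_cone :: "'a::real_vector set \<Rightarrow> 'a set" where
  "recession_cone \<Omega> = {u. \<forall>\<omega>\<in>\<Omega>. \<forall>l\<ge>0. \<omega> + l *\<^sub>R u \<in> \<Omega>}"

end

theory Submission
  imports Defs
begin

text \<open>
  Perturbing a point x by y - x costs at most an extra travel time s = norm (y - x) / \<delta>, because
  the epi-Lipschitz property absorbs y - x into the direction: s v + (y - x) = s u with
  u within \<delta> of v.
  Conversely, \<omega> + \<lambda> u is reached from \<omega> + \<lambda> (u - v) by travelling in direction v for
  time \<lambda>; by the Lipschitz bound the target is already hit strictly before \<lambda>, and since v is a
  recession direction the trajectory then stays in \<Omega>.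
\<close>

lemma dir_min_time_le:
  assumes "0 \<le> t" "x + t *\<^sub>R v \<in> \<Omega>"
  shows "dir_min_time \<Omega> v x \<le> ereal t"
  unfolding dir_min_time_def using assms by (intro Inf_lower) auto

lemma dir_min_time_greatest:
  assumes "\<And>t. 0 \<le> t \<Longrightarrow> x + t *\<^sub>R v \<in> \<Omega> \<Longrightarrow> c \<le> ereal t"
  shows "c \<le> dir_min_time \<Omega> v x"
  unfolding dir_min_time_def using assms by (intro Inf_greatest) auto

lemma dir_min_time_lessE:
  assumes "dir_min_time \<Omega> v x < ereal c"
  obtains t where "0 \<le> t" "t < c" "x + t *\<^sub>R v \<in> \<Omega>"
  using assms unfolding dir_min_time_def Inf_less_iff by auto

lemma dir_min_time_eq_0:
  assumes "x \<in> \<Omega>"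
  shows "dir_min_time \<Omega> v x = 0"
  using dir_min_time_le[of 0 x v \<Omega>] dir_min_time_nonneg[of \<Omega> v x] assms
  by (simp add: zero_ereal_def antisym)

text \<open>The smallness \<open>norm e \<le> \<delta>\<^sup>2\<close> says exactly that the extra
  time \<open>norm e / \<delta>\<close> is an admissible step length, at most
  \<open>\<delta>\<close>.\<close>

lemma epi_Lipschitz_perturb:
  fixes \<omega> e v :: "'a::real_normed_vector"
  assumes "\<delta> > 0"
    and epi: "\<And>u l. u \<in> cball v \<delta> \<Longrightarrow> l \<in> {0..\<delta>} \<Longrightarrow> \<omega> + l *\<^sub>R u \<in> \<Omega>"
    and "norm e \<le> \<delta>\<^sup>2"
  shows "\<omega> + e + (norm e / \<delta>) *\<^sub>R v \<in> \<Omega>"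
proof -
  define s where "s = norm e / \<delta>"
  \<comment> \<open>For \<open>e \<noteq> 0\<close> the correction to \<open>v\<close> has norm
    exactly \<open>\<delta>\<close>. For \<open>e = 0\<close> division by zero gives
    \<open>1 / s = 0\<close>, hence \<open>u = v\<close>.\<close>
  define u where "u = v + (1 / s) *\<^sub>R e"
  have "s \<in> {0..\<delta>}"
    using assms by (auto simp: s_def divide_simps power2_eq_square)
  moreover have "u \<in> cball v \<delta>"
    using \<open>\<delta> > 0\<close> by (auto simp: u_def s_def dist_norm)
  ultimately have "\<omega> + s *\<^sub>R u \<in> \<Omega>"
    by (rule epi[rotated])
  moreover have "s *\<^sub>R u = e + s *\<^sub>R v"
    using \<open>\<delta> > 0\<close> by (cases "e = 0") (auto simp: u_def s_def algebra_simps)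
  ultimately show ?thesis
    by (simp add: s_def add.assoc)
qed

lemma Lipschitz_around_dir_min_time:
  fixes v xbar :: "'a::real_normed_vector"
  assumes "xbar \<in> \<Omega>" "epi_Lipschitz_at \<Omega> xbar v"
  shows "Lipschitz_around (dir_min_time \<Omega> v) xbar"
proof -
  let ?T = "dir_min_time \<Omega> v"
  obtain \<delta> where "\<delta> > 0" and
    epi: "\<And>\<omega> u l. \<omega> \<in> \<Omega> \<inter> cball xbar \<delta> \<Longrightarrow> u \<in> cball v \<delta> \<Longrightarrow> l \<in> {0..\<delta>} \<Longrightarrow> \<omega> + l *\<^sub>R u \<in> \<Omega>"
    using assms(2) unfolding epi_Lipschitz_at_def by blast
  have perturb: "\<omega> + e + (norm e / \<delta>) *\<^sub>R v \<in> \<Omega>"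
    if "\<omega> \<in> \<Omega>" "norm (\<omega> - xbar) \<le> \<delta>" "norm e \<le> \<delta>\<^sup>2" for \<omega> e
    using that \<open>\<delta> > 0\<close> epi[of \<omega>]
    by (intro epi_Lipschitz_perturb) (auto simp: dist_norm norm_minus_commute)
  \<comment> \<open>The first entry lets any difference of two points of the r-ball serve as a
    perturbation \<open>e\<close>. The second keeps \<open>x + t *\<^sub>R v\<close> within
    \<open>\<delta>\<close> of \<open>xbar\<close> whenever \<open>x\<close> is in the r-ball and
    \<open>t \<le> r / \<delta>\<close>.\<close>
  define r where "r = min (\<delta>\<^sup>2 / 2) (\<delta> / (1 + norm v / \<delta>))"
  have pos: "1 + norm v / \<delta> > 0"
    using \<open>\<delta> > 0\<close> by (intro add_pos_nonneg) auto
  then have "r > 0"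
    using \<open>\<delta> > 0\<close> by (simp add: r_def)
  have "r \<le> \<delta>\<^sup>2 / 2"
    unfolding r_def by (rule min.cobounded1)
  then have r2: "2 * r \<le> \<delta>\<^sup>2"
    by simp
  have "r \<le> \<delta> / (1 + norm v / \<delta>)"
    by (simp add: r_def)
  then have "r * (1 + norm v / \<delta>) \<le> \<delta>"
    using pos by (simp only: pos_le_divide_eq)
  then have rv: "r + r / \<delta> * norm v \<le> \<delta>"
    by (simp add: algebra_simps)
  \<comment> \<open>Perturbing \<open>xbar\<close> itself bounds \<open>?T\<close> uniformly on the
    r-ball. This gives finiteness and also disposes of late hitting times below.\<close>
  have bound: "?T y \<le> ereal (r / \<delta>)" if "norm (y - xbar) \<le> r" for y
  proof -
    have "xbar + (y - xbar) + (norm (y - xbar) / \<delta>) *\<^sub>R v \<in> \<Omega>"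
      using assms(1) \<open>\<delta> > 0\<close> \<open>r > 0\<close> r2 that by (intro perturb) auto
    then have "?T y \<le> ereal (norm (y - xbar) / \<delta>)"
      using \<open>\<delta> > 0\<close> by (intro dir_min_time_le) auto
    also have "\<dots> \<le> ereal (r / \<delta>)"
      using that \<open>\<delta> > 0\<close> by (simp add: divide_right_mono)
    finally show ?thesis .
  qed
  have finite: "\<bar>?T y\<bar> \<noteq> \<infinity>" if "norm (y - xbar) \<le> r" for y
    using bound[OF that] dir_min_time_nonneg[of \<Omega> v y] by auto
  have step: "?T y \<le> ?T x + ereal (norm (y - x) / \<delta>)"
    if x: "norm (x - xbar) \<le> r" and y: "norm (y - xbar) \<le> r" for x y
  proof -
    have nyx: "norm (y - x) \<le> 2 * r"
      using norm_triangle_ineq4[of "y - xbar" "x - xbar"] x y by simp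
    \<comment> \<open>With the finite term moved to the left, the claim is a lower bound for an
      infimum and can be checked at each hitting time \<open>t\<close> of \<open>x\<close>.\<close>
    have "?T y - ereal (norm (y - x) / \<delta>) \<le> ?T x"
    proof (rule dir_min_time_greatest)
      fix t assume t: "0 \<le> t" "x + t *\<^sub>R v \<in> \<Omega>"
      have "?T y \<le> ereal (t + norm (y - x) / \<delta>)"
      \<comment> \<open>A late hitting point may lie outside the ball where \<open>perturb\<close>
        applies, but then \<open>bound\<close> alone suffices. An early one stays in that
        ball.\<close>
      proof (cases "r / \<delta> \<le> t")
        case True
        then have "r / \<delta> \<le> t + norm (y - x) / \<delta>"
          using \<open>\<delta> > 0\<close> by (intro add_increasing2) auto
        then show ?thesis
          using bound[OF y] by (meson ereal_less_eq(3) order_trans)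
      next
        case False
        have "norm (x + t *\<^sub>R v - xbar) \<le> norm (x - xbar) + t * norm v"
          using norm_triangle_ineq[of "x - xbar" "t *\<^sub>R v"] t by (simp add: algebra_simps)
        also have "\<dots> \<le> r + r / \<delta> * norm v"
          using x False by (intro add_mono mult_right_mono) auto
        finally have "norm (x + t *\<^sub>R v - xbar) \<le> \<delta>"
          using rv by simp
        \<comment> \<open>The hitting point of \<open>x\<close> is shifted by \<open>y - x\<close>;
          the resulting point lies on the ray from \<open>y\<close>, at time
          \<open>t + norm (y - x) / \<delta>\<close>.\<close>
        then have "x + t *\<^sub>R v + (y - x) + (norm (y - x) / \<delta>) *\<^sub>R v \<in> \<Omega>"
          using t nyx r2 by (intro perturb) auto
        then show ?thesis
          using t \<open>\<delta> > 0\<close> by (intro dir_min_time_le) (auto simp: algebra_simps)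
      qed
      then show "?T y - ereal (norm (y - x) / \<delta>) \<le> ereal t"
        by (simp add: ereal_minus_le)
    qed
    then show ?thesis
      by (simp add: ereal_minus_le)
  qed
  have "\<bar>?T y - ?T z\<bar> \<le> ereal (1 / \<delta> * norm (y - z))"
    if y: "norm (y - xbar) \<le> r" and z: "norm (z - xbar) \<le> r" for y z
    using step[OF y z] step[OF z y] finite[OF y] finite[OF z]
    by (cases "?T y"; cases "?T z") (auto simp: norm_minus_commute abs_le_iff)
  then show ?thesis
    unfolding Lipschitz_around_def using finite \<open>\<delta> > 0\<close> \<open>r > 0\<close>
    by (intro exI[of _ "1 / \<delta>"] conjI exI[of _ r])
      (auto simp: dist_norm norm_minus_commute)
qed

lemma epi_Lipschitz_at_if_Lipschitz_around:
  fixes v xbar :: "'a::real_normed_vector"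
  assumes "v \<noteq> 0" "v \<in> recession_cone \<Omega>" "Lipschitz_around (dir_min_time \<Omega> v) xbar"
  shows "epi_Lipschitz_at \<Omega> xbar v"
proof -
  let ?T = "dir_min_time \<Omega> v"
  obtain L \<delta> where "L \<ge> 0" "\<delta> > 0" and
    lip: "\<And>y z. y \<in> cball xbar \<delta> \<Longrightarrow> z \<in> cball xbar \<delta> \<Longrightarrow> \<bar>?T y - ?T z\<bar> \<le> ereal (L * norm (y - z))"
    using assms(3) unfolding Lipschitz_around_def by blast
  \<comment> \<open>The bounds \<open>\<delta> / 2\<close> and \<open>1\<close> keep
    \<open>\<omega>\<close> and the shifted point \<open>w\<close> in the Lipschitz ball;
    \<open>1 / (L + 1)\<close> forces the strict inequality
    \<open>L * \<epsilon> < 1\<close>.\<close>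
  define \<epsilon> where "\<epsilon> = min (\<delta> / 2) (min 1 (1 / (L + 1)))"
  have eps: "\<epsilon> > 0" "\<epsilon> \<le> \<delta> / 2" "\<epsilon> \<le> 1" "\<epsilon> \<le> 1 / (L + 1)"
    using \<open>L \<ge> 0\<close> \<open>\<delta> > 0\<close> by (auto simp: \<epsilon>_def min_le_iff_disj)
  then have "(L + 1) * \<epsilon> \<le> 1"
    using \<open>L \<ge> 0\<close> by (simp add: field_simps)
  then have L\<epsilon>: "L * \<epsilon> < 1"
    using eps by (simp add: algebra_simps)
  have "\<omega> + l *\<^sub>R u \<in> \<Omega>"
    if \<omega>: "\<omega> \<in> \<Omega>" "dist xbar \<omega> \<le> \<epsilon>" and u: "dist v u \<le> \<epsilon>" and l: "0 \<le> l" "l \<le> \<epsilon>" for \<omega> u l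
  \<comment> \<open>The strict estimate \<open>l * (L * \<epsilon>) < l\<close> used below requires
    \<open>l > 0\<close>.\<close>
  proof (cases "l = 0")
    case True
    then show ?thesis using \<omega> by simp
  next
    case False
    define w where "w = \<omega> + l *\<^sub>R (u - v)"
    have nu: "norm (u - v) \<le> \<epsilon>"
      using u by (simp add: dist_norm norm_minus_commute)
    have nw: "norm (w - \<omega>) = l * norm (u - v)"
      using l by (simp add: w_def)
    have "l * norm (u - v) \<le> 1 * \<epsilon>"
      using l nu eps by (intro mult_mono) auto
    then have "dist xbar w \<le> \<delta>"
      using dist_triangle[of xbar w \<omega>] \<omega> eps nw by (simp add: dist_norm norm_minus_commute)
    then have "\<bar>?T w - ?T \<omega>\<bar> \<le> ereal (L * norm (w - \<omega>))"
      using \<omega> eps by (intro lip) auto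
    \<comment> \<open>Since \<open>?T\<close> vanishes at \<open>\<omega>\<close>, the Lipschitz
      estimate bounds \<open>?T w\<close> itself.\<close>
    then have "?T w \<le> ereal (L * norm (w - \<omega>))"
      using dir_min_time_eq_0[OF \<omega>(1)] dir_min_time_nonneg[of \<Omega> v w] by simp
    also have "L * norm (w - \<omega>) \<le> l * (L * \<epsilon>)"
      using mult_left_mono[OF nu, of "L * l"] l \<open>L \<ge> 0\<close> by (simp add: nw mult_ac)
    also have "l * (L * \<epsilon>) < l * 1"
      using L\<epsilon> l False by (intro mult_strict_left_mono) auto
    finally have "?T w < ereal l"
      by simp
    \<comment> \<open>The strict bound on the infimum yields an actual hitting time
      \<open>t < l\<close>; the remaining time \<open>l - t\<close> leads along \<open>v\<close> to
      \<open>w + l *\<^sub>R v\<close>, which is \<open>\<omega> + l *\<^sub>R u\<close>.\<close>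
    then obtain t where t: "0 \<le> t" "t < l" "w + t *\<^sub>R v \<in> \<Omega>"
      by (rule dir_min_time_lessE)
    then have "w + t *\<^sub>R v + (l - t) *\<^sub>R v \<in> \<Omega>"
      using assms(2) unfolding recession_cone_def by simp
    then show ?thesis
      by (simp add: w_def algebra_simps)
  qed
  then show ?thesis
    unfolding epi_Lipschitz_at_def using assms(1) eps
    by (intro conjI exI[of _ \<epsilon>]) auto
qed

theorem theorem4p5:
  fixes \<Omega> :: "'a::real_normed_vector set" and v xbar :: 'a
  assumes "\<Omega> \<noteq> {}" and "closed \<Omega>" and "v \<noteq> 0" and "xbar \<in> \<Omega>"
  shows "(epi_Lipschitz_at \<Omega> xbar v \<longrightarrow> Lipschitz_around (dir_min_time \<Omega> v) xbar) \<and>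
         (v \<in> recession_cone \<Omega> \<longrightarrow>
            Lipschitz_around (dir_min_time \<Omega> v) xbar \<longrightarrow> epi_Lipschitz_at \<Omega> xbar v)"
  using assms Lipschitz_around_dir_min_time epi_Lipschitz_at_if_Lipschitz_around by blast

end
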